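(* Let $A, B, B', C, \mathbb{X}\in\mathbb{C}^{r\times r}$ be such that $A$, $B$, $B'$, $C$, $C-A$ and $\mathbb{X}$ are positive stable, $A$, $C$, $\mathbb{X}$ commute with each other, $CB=BC$ and $CB'=B'C$. Let $z,w\in\mathbb{C}$ with $|z|<1$, $|w|<1$. Then $$F_{1}(A,B,B';C;z,w;\mathbb{X})=\Gamma(C)\Gamma^{-1}(A)\Gamma^{-1}(C-A)\int_{0}^{1}u^{A-I}(1-u)^{C-A-I}\exp\Big(\frac{-\mathbb{X}}{u(1-u)}\Big)(1-zu)^{-B}(1-wu)^{-B'}\,du .$$
   Context: $\mathbb{C}^{r\times r}$ is the space of complex $r\times r$ matrices and $I$ is the identity. A matrix is positive stable if all its eigenvalues have positive real part. For $t>0$, $t^{M}=\exp(M\log t)$; for $|s|<1$, $(1-s)^{-M}=\exp(-M\,\mathrm{Log}(1-s))$ with the principal logarithm. For positive stable $M$, $\Gamma(M)=\int_0^\infty e^{-t}t^{M-I}dt$, and $\Gamma^{-1}(M)$ is its inverse. The Pochhammer symbol is $(M)_0=I$, $(M)_n=M(M+I)\cdots(M+(n-1)I)$ for $n\ge1$. Extended beta matrix function: for commuting positive stable matrices $P,Q,\mathbb{X}$, $$\mathfrak{B}(P,Q;\mathbb{X})=\int_0^1 t^{P-I}(1-t)^{Q-I}\exp\Big(\frac{-\mathbb{X}}{t(1-t)}\Big)dt.$$ Extended Appell matrix function $F_1$ (order of the factors matters): $$F_{1}(A,B,B';C;z,w;\mathbb{X})=\Gamma(C)\Gamma^{-1}(A)\Gamma^{-1}(C-A)\sum_{m,n\ge0}\mathfrak{B}(A+(m+n)I,C-A;\mathbb{X})\,(B)_m(B')_n\frac{z^mw^n}{m!\,n!}.$$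 *)

theory Defs
  imports "HOL-Analysis.Analysis"
begin

(* Class multiplication on complex^'r^'r is entrywise, so the class operations of power and
   exp cannot be used for matrices; the versions below are built from the matrix product. *)

abbreviation cscale :: "complex \<Rightarrow> complex^'r^'r \<Rightarrow> complex^'r^'r" (infixr "*\<^sub>C" 75) where
  "c *\<^sub>C M \<equiv> map_matrix ((*) c) M"

primrec matpow :: "complex^'r^'r \<Rightarrow> nat \<Rightarrow> complex^'r^'r" where
  "matpow M 0 = mat 1"
| "matpow M (Suc n) = M ** matpow M n"

definition matexp :: "complex^'r^'r \<Rightarrow> complex^'r^'r" where
  "matexp M = (\<Sum>n. (1 / fact n) *\<^sub>R matpow M n)"

definition mat_eigenvalue :: "complex^'r^'r \<Rightarrow> complex \<Rightarrow> bool" where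
  "mat_eigenvalue M l \<longleftrightarrow> (\<exists>v. v \<noteq> 0 \<and> M *v v = l *s v)"

definition positive_stable :: "complex^'r^'r \<Rightarrow> bool" where
  "positive_stable M \<longleftrightarrow> (\<forall>l. mat_eigenvalue M l \<longrightarrow> 0 < Re l)"

(* t^M, meant for t > 0 *)
definition matpowr :: "real \<Rightarrow> complex^'r^'r \<Rightarrow> complex^'r^'r" where
  "matpowr t M = matexp (ln t *\<^sub>R M)"

(* (1 - s)^(-M), meant for |s| < 1; Ln is the principal logarithm *)
definition one_minus_powr_neg :: "complex \<Rightarrow> complex^'r^'r \<Rightarrow> complex^'r^'r" where
  "one_minus_powr_neg s M = matexp (- (Ln (1 - s) *\<^sub>C M))"

primrec matpochhammer :: "complex^'r^'r \<Rightarrow> nat \<Rightarrow> complex^'r^'r" where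
  "matpochhammer M 0 = mat 1"
| "matpochhammer M (Suc n) = matpochhammer M n ** (M + mat (of_nat n))"

definition matGamma :: "complex^'r^'r \<Rightarrow> complex^'r^'r" where
  "matGamma M = (LINT t:{0<..}|lborel. exp (- t) *\<^sub>R matpowr t (M - mat 1))"

definition ext_beta :: "complex^'r^'r \<Rightarrow> complex^'r^'r \<Rightarrow> complex^'r^'r \<Rightarrow> complex^'r^'r" where
  "ext_beta P Q X = (LINT t:{0<..<1}|lborel.
     matpowr t (P - mat 1) ** matpowr (1 - t) (Q - mat 1) ** matexp ((- 1 / (t * (1 - t))) *\<^sub>R X))"

definition ext_appell_F1_term ::
  "complex^'r^'r \<Rightarrow> complex^'r^'r \<Rightarrow> complex^'r^'r \<Rightarrow> complex^'r^'r \<Rightarrow> complex \<Rightarrow> complex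
     \<Rightarrow> complex^'r^'r \<Rightarrow> nat \<times> nat \<Rightarrow> complex^'r^'r" where
  "ext_appell_F1_term A B B' C z w X = (\<lambda>(m, n).
     (z ^ m * w ^ n / (fact m * fact n)) *\<^sub>C
       (ext_beta (A + mat (of_nat (m + n))) (C - A) X ** matpochhammer B m ** matpochhammer B' n))"

definition ext_appell_F1 ::
  "complex^'r^'r \<Rightarrow> complex^'r^'r \<Rightarrow> complex^'r^'r \<Rightarrow> complex^'r^'r \<Rightarrow> complex \<Rightarrow> complex
     \<Rightarrow> complex^'r^'r \<Rightarrow> complex^'r^'r" where
  "ext_appell_F1 A B B' C z w X =
     matGamma C ** matrix_inv (matGamma A) ** matrix_inv (matGamma (C - A)) **
       infsum (ext_appell_F1_term A B B' C z w X) UNIV"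

end

theory Submission
  imports Defs "HOL-Computational_Algebra.Fundamental_Theorem_Algebra"
begin

text \<open>
  Both sides carry the same constant factor, so the claim is that the double series of integrals is
  the integral of the double series. Expanding \<open>(1 - z u)\<^sup>-\<^sup>B\<close> and \<open>(1 - w u)\<^sup>-\<^sup>B'\<close> in binomial series and
  absorbing \<open>u\<^sup>m\<^sup>+\<^sup>n\<close> into \<open>u\<^sup>A\<^sup>-\<^sup>I\<close> identifies the summands; the matrix order is never changed.
  The interchange is dominated: as \<open>X\<close> is positive stable, \<open>exp (- s X)\<close> decays faster than any
  power of \<open>s\<close>, so the beta kernel is bounded on the unit interval, and the norms of the
  binomial coefficients give two convergent series in \<open>|z|\<close> and \<open>|w|\<close>.
\<close>

section \<open>The matrix exponential\<close>

lemma bounded_bilinear_matrix_mult: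
  "bounded_bilinear ((**) :: complex^'m^'n \<Rightarrow> complex^'p^'m \<Rightarrow> complex^'p^'n)"
proof -
  have "bilinear ((**) :: complex^'m^'n \<Rightarrow> complex^'p^'m \<Rightarrow> complex^'p^'n)"
    unfolding bilinear_def
    by (auto intro!: linearI simp: vec_eq_iff matrix_matrix_mult_def sum.distrib distrib_left
        distrib_right scaleR_sum_right)
  then show ?thesis by (simp add: bilinear_conv_bounded_bilinear)
qed

interpretation matmul: bounded_bilinear
  "(**) :: complex^'m^'n \<Rightarrow> complex^'p^'m \<Rightarrow> complex^'p^'n"
  by (rule bounded_bilinear_matrix_mult)

lemma norm_entry_le: "norm (M $ i $ j) \<le> norm (M :: complex^'m^'n)"
  by (rule order_trans[OF Finite_Cartesian_Product.norm_nth_le Finite_Cartesian_Product.norm_nth_le])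

lemma norm_le_sum_entries: "norm (M :: complex^'m^'n) \<le> (\<Sum>i\<in>UNIV. \<Sum>j\<in>UNIV. norm (M $ i $ j))"
proof -
  have row: "norm v \<le> (\<Sum>j\<in>UNIV. norm (v $ j))" for v :: "complex^'m"
    unfolding norm_vec_def by (rule L2_set_le_sum) simp
  have "norm M \<le> (\<Sum>i\<in>UNIV. norm (M $ i))"
    unfolding norm_vec_def[of M] by (rule L2_set_le_sum) simp
  also have "\<dots> \<le> (\<Sum>i\<in>UNIV. \<Sum>j\<in>UNIV. norm (M $ i $ j))"
    by (intro sum_mono row)
  finally show ?thesis .
qed

lemma norm_le_of_entries_le:
  fixes M :: "complex^'m^'n" and c :: real
  assumes "\<And>i j. norm (M $ i $ j) \<le> c"
  shows "norm M \<le> CARD('n) * CARD('m) * c"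
proof -
  have "norm M \<le> (\<Sum>i\<in>(UNIV::'n set). \<Sum>j\<in>(UNIV::'m set). c)"
    by (rule order_trans[OF norm_le_sum_entries]) (intro sum_mono assms)
  then show ?thesis by simp
qed

text \<open>Passing to entries makes the scalar theory of power series available for matrix
  series.\<close>

lemma sums_matrix_iff:
  fixes f :: "nat \<Rightarrow> complex^'m^'n"
  shows "f sums S \<longleftrightarrow> (\<forall>i j. (\<lambda>n. f n $ i $ j) sums (S $ i $ j))"
proof -
  have "f sums S \<longleftrightarrow> (\<forall>i j. (\<lambda>n. (\<Sum>k<n. f k) $ i $ j) \<longlonglongrightarrow> S $ i $ j)"
    unfolding sums_def
  proof (intro iffI allI)
    show "(\<lambda>n. (\<Sum>k<n. f k) $ i $ j) \<longlonglongrightarrow> S $ i $ j" if "(\<lambda>n. \<Sum>k<n. f k) \<longlonglongrightarrow> S" for i j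
      by (rule tendsto_vec_nth, rule tendsto_vec_nth) (rule that)
    show "(\<lambda>n. \<Sum>k<n. f k) \<longlonglongrightarrow> S" if "\<forall>i j. (\<lambda>n. (\<Sum>k<n. f k) $ i $ j) \<longlonglongrightarrow> S $ i $ j"
      by (rule vec_tendstoI, rule vec_tendstoI) (rule that[rule_format])
  qed
  then show ?thesis by (simp add: sums_def)
qed

lemma cscale_matrix_mult: "(c *\<^sub>C M) ** N = c *\<^sub>C (M ** N)"
  by (simp add: vec_eq_iff matrix_matrix_mult_def sum_distrib_left mult.assoc)

lemma matrix_mult_cscale: "M ** (c *\<^sub>C N) = c *\<^sub>C (M ** N)"
  by (simp add: vec_eq_iff matrix_matrix_mult_def sum_distrib_left mult.left_commute)

lemma cscale_cscale: "a *\<^sub>C b *\<^sub>C M = (a * b) *\<^sub>C M"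
  by (simp add: vec_eq_iff mult.assoc)

lemma scaleR_entry: "(c *\<^sub>R M) $ i $ j = of_real c * (M :: complex^'m^'n) $ i $ j"
  unfolding vector_scaleR_component by (rule scaleR_conv_of_real)

lemma cscale_of_real: "of_real c *\<^sub>C M = c *\<^sub>R M"
  by (simp add: vec_eq_iff scaleR_entry del: vector_scaleR_component)

lemma cscale_0_left [simp]: "0 *\<^sub>C M = 0"
  by (simp add: vec_eq_iff)

lemma cscale_1_left [simp]: "1 *\<^sub>C M = M"
  by (simp add: vec_eq_iff)

lemma mat_matrix_mult: "mat a ** M = a *\<^sub>C (M :: complex^'r^'r)"
  by (simp add: vec_eq_iff matrix_matrix_mult_def mat_def if_distrib[of "\<lambda>x. x * _"] cong: if_cong)

lemma matrix_mult_mat: "M ** mat a = a *\<^sub>C (M :: complex^'r^'r)"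
  by (simp add: vec_eq_iff matrix_matrix_mult_def mat_def if_distrib[of "\<lambda>x. _ * x"] mult.commute cong: if_cong)

lemma bounded_linear_cscale: "bounded_linear (\<lambda>M :: complex^'r^'r. c *\<^sub>C M)"
proof -
  have "linear (\<lambda>M :: complex^'r^'r. c *\<^sub>C M)"
    by (auto intro!: linearI simp: vec_eq_iff algebra_simps)
  then show ?thesis by (simp add: linear_conv_bounded_linear)
qed

lemma norm_cscale: "norm (c *\<^sub>C M) = norm c * norm (M :: complex^'r^'r)"
proof -
  have "norm (\<chi> j. c * v $ j) = norm c * norm v" for v :: "complex^'r"
    by (simp add: norm_vec_def norm_mult L2_set_right_distrib)
  then have "norm ((c *\<^sub>C M) $ i) = norm c * norm (M $ i)" for i
    by (simp add: map_matrix_def)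
  then show ?thesis
    by (simp add: norm_vec_def[of "c *\<^sub>C M"] norm_vec_def[of M] L2_set_right_distrib)
qed

section \<open>The exponential series\<close>

lemma matpow_cscale: "matpow (c *\<^sub>C M) n = c ^ n *\<^sub>C matpow M n"
proof (induction n)
  case 0 show ?case by (simp add: vec_eq_iff)
next
  case (Suc n) then show ?case
    by (simp add: cscale_matrix_mult matrix_mult_cscale cscale_cscale mult.commute[of c "c ^ n"])
qed

text \<open>An entry of a product is a sum of \<open>CARD('r)\<close> terms, hence one factor
  \<open>CARD('r) * norm M\<close> per multiplication.\<close>

lemma norm_matpow_entry_le:
  "norm (matpow M n $ i $ j) \<le> (CARD('r) * norm (M :: complex^'r^'r)) ^ n"
proof (induction n arbitrary: i)
  case 0 show ?case by (simp add: mat_def)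
next
  case (Suc n)
  have "norm (matpow M (Suc n) $ i $ j) \<le> (\<Sum>k\<in>UNIV. norm (M $ i $ k * matpow M n $ k $ j))"
    by (simp add: matrix_matrix_mult_def norm_sum)
  also have "\<dots> \<le> (\<Sum>k\<in>(UNIV::'r set). norm M * (CARD('r) * norm M) ^ n)"
    unfolding norm_mult by (intro sum_mono mult_mono norm_entry_le Suc) auto
  finally show ?case by simp
qed

lemma norm_matexp_term_le:
  "norm (matpow M n $ i $ j / fact n) \<le> inverse (fact n) * (CARD('r) * norm (M :: complex^'r^'r)) ^ n"
  using divide_right_mono[OF norm_matpow_entry_le[of M n i j], of "fact n"]
  by (simp add: norm_divide norm_mult norm_inverse divide_inverse_commute)

lemma summable_matexp_entry: "summable (\<lambda>n. matpow (M :: complex^'r^'r) n $ i $ j / fact n * c ^ n)"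
proof (rule summable_comparison_test')
  show "summable (\<lambda>n. inverse (fact n) * (CARD('r) * norm M * norm c) ^ n)"
    by (rule summable_exp)
  show "norm (matpow M n $ i $ j / fact n * c ^ n) \<le> inverse (fact n) * (CARD('r) * norm M * norm c) ^ n"
    if "n \<ge> 0" for n
    using mult_right_mono[OF norm_matexp_term_le[of M n i j], of "norm c ^ n"]
    by (simp only: norm_mult norm_power power_mult_distrib mult.assoc zero_le_power norm_ge_zero simp_thms)
qed

text \<open>With the scalar \<open>c\<close> kept apart from \<open>M\<close>, every entry is an
  everywhere convergent power series in \<open>c\<close>, so it can be differentiated
  termwise.\<close>

lemma matexp_entry: "matexp (c *\<^sub>C M) $ i $ j = (\<Sum>n. matpow M n $ i $ j / fact n * c ^ n)"
proof -
  have "(\<lambda>n. (1 / fact n) *\<^sub>R matpow (c *\<^sub>C M) n) sums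
      (\<chi> i j. \<Sum>n. matpow M n $ i $ j / fact n * c ^ n)"
    unfolding sums_matrix_iff
  proof (intro allI)
    fix i j
    have "((1 / fact n) *\<^sub>R matpow (c *\<^sub>C M) n) $ i $ j = matpow M n $ i $ j / fact n * c ^ n" for n
      by (simp add: matpow_cscale scaleR_entry del: vector_scaleR_component)
    then show "(\<lambda>n. ((1 / fact n) *\<^sub>R matpow (c *\<^sub>C M) n) $ i $ j) sums
        (\<chi> i j. \<Sum>n. matpow M n $ i $ j / fact n * c ^ n) $ i $ j"
      using summable_sums[OF summable_matexp_entry[of M i j c]] by simp
  qed
  then show ?thesis by (simp add: matexp_def sums_iff)
qed

lemma norm_matexp_le:
  "norm (matexp M) \<le> CARD('r) * CARD('r) * exp (CARD('r) * norm (M :: complex^'r^'r))"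
proof (rule norm_le_of_entries_le)
  fix i j
  have "norm (matexp M $ i $ j) = norm (\<Sum>n. matpow M n $ i $ j / fact n)"
    using matexp_entry[of 1 M i j] by simp
  also have "\<dots> \<le> (\<Sum>n. inverse (fact n) * (CARD('r) * norm M) ^ n)"
    by (rule norm_suminf_le[OF norm_matexp_term_le summable_exp])
  also have "\<dots> = exp (CARD('r) * norm M)"
    by (simp add: exp_def)
  finally show "norm (matexp M $ i $ j) \<le> exp (CARD('r) * norm M)" .
qed

lemma matpow_matrix_mult_commute:
  assumes "M ** N = N ** M" shows "matpow M n ** N = N ** matpow M n"
proof (induction n)
  case (Suc n) then show ?case
    by (simp, metis assms matrix_mul_assoc)
qed simp

section \<open>The linear differential equation of the exponential and its uniqueness\<close>

lemma has_derivative_matexp_entry: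
  "((\<lambda>c. matexp (c *\<^sub>C M) $ i $ j) has_field_derivative (M ** matexp (c *\<^sub>C M)) $ i $ j) (at c)"
proof -
  define a where "a n i j = matpow M n $ i $ j / fact n" for n i j
  have sm: "summable (\<lambda>n. a n i j * x ^ n)" for x i j
    unfolding a_def by (rule summable_matexp_entry)
  have "((\<lambda>c. \<Sum>n. a n i j * c ^ n) has_field_derivative (\<Sum>n. diffs (\<lambda>n. a n i j) n * c ^ n)) (at c)"
    by (rule termdiffs_strong_converges_everywhere[OF sm])
  moreover have "(\<Sum>n. diffs (\<lambda>n. a n i j) n * c ^ n) = (M ** matexp (c *\<^sub>C M)) $ i $ j"
  proof -
    have "diffs (\<lambda>n. a n i j) n * c ^ n = (\<Sum>k\<in>UNIV. M $ i $ k * (a n k j * c ^ n))" for n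
    proof -
      \<comment> \<open>The factor \<open>n + 1\<close> from differentiation reduces
        \<open>fact (n + 1)\<close> to \<open>fact n\<close>; since \<open>matpow\<close> adds
        factors on the left, \<open>M\<close> then comes out in front.\<close>
      have "diffs (\<lambda>n. a n i j) n = matpow M (Suc n) $ i $ j / fact n"
        by (simp add: diffs_def a_def del: matpow.simps of_nat_Suc)
      then show ?thesis
        by (simp add: matrix_matrix_mult_def a_def sum_divide_distrib sum_distrib_left
            sum_distrib_right mult_ac)
    qed
    moreover have "(\<lambda>n. \<Sum>k\<in>UNIV. M $ i $ k * (a n k j * c ^ n)) sums
        (\<Sum>k\<in>UNIV. M $ i $ k * matexp (c *\<^sub>C M) $ k $ j)"
      by (intro sums_sum sums_mult) (simp add: matexp_entry a_def[symmetric] summable_sums sm)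
    ultimately show ?thesis
      by (simp add: matrix_matrix_mult_def sums_iff)
  qed
  ultimately show ?thesis
    by (simp add: matexp_entry a_def)
qed

lemma has_derivative_matrix_mult_entry:
  fixes F :: "complex \<Rightarrow> complex^'m^'n" and G :: "complex \<Rightarrow> complex^'p^'m"
  assumes "\<And>i j. ((\<lambda>s. F s $ i $ j) has_field_derivative F' $ i $ j) (at s)"
    and "\<And>i j. ((\<lambda>s. G s $ i $ j) has_field_derivative G' $ i $ j) (at s)"
  shows "((\<lambda>s. (F s ** G s) $ i $ j) has_field_derivative (F' ** G s + F s ** G') $ i $ j) (at s)"
proof -
  have "((\<lambda>s. \<Sum>k\<in>UNIV. F s $ i $ k * G s $ k $ j) has_field_derivative
      (\<Sum>k\<in>UNIV. F' $ i $ k * G s $ k $ j + F s $ i $ k * G' $ k $ j)) (at s)"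
    by (intro DERIV_sum) (auto intro!: derivative_eq_intros assms)
  then show ?thesis
    by (simp add: matrix_matrix_mult_def sum.distrib)
qed

lemma matexp_zero [simp]: "matexp 0 = (mat 1 :: complex^'r^'r)"
proof -
  have "matexp (0 *\<^sub>C 0) $ i $ j = (mat 1 :: complex^'r^'r) $ i $ j" for i j
  proof -
    have "(\<lambda>n. matpow (0 :: complex^'r^'r) n $ i $ j / fact n * 0 ^ n) sums
        (matpow (0 :: complex^'r^'r) 0 $ i $ j / fact 0)"
      using powser_sums_zero[of "\<lambda>n. matpow (0 :: complex^'r^'r) n $ i $ j / fact n"] by simp
    then show ?thesis using matexp_entry[of 0 "0 :: complex^'r^'r" i j] by (simp add: sums_iff)
  qed
  then show ?thesis by (simp add: vec_eq_iff)
qed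

lemma matexp_commute:
  assumes "M ** N = N ** M"
  shows "matexp M ** N = N ** matexp (M :: complex^'r^'r)"
proof -
  have sums: "(\<lambda>n. (1 / fact n) *\<^sub>R matpow M n) sums matexp M"
    unfolding sums_matrix_iff
    using summable_sums[OF summable_matexp_entry[of M _ _ 1]] matexp_entry[of 1 M]
    by (simp add: scaleR_entry divide_inverse mult.commute del: vector_scaleR_component)
  have "(\<lambda>n. ((1 / fact n) *\<^sub>R matpow M n) ** N) sums (matexp M ** N)"
    using bounded_linear.sums[OF matmul.bounded_linear_left sums] .
  moreover have "(\<lambda>n. N ** ((1 / fact n) *\<^sub>R matpow M n)) sums (N ** matexp M)"
    using bounded_linear.sums[OF matmul.bounded_linear_right sums] .
  ultimately show ?thesis
    using sums_unique2 by (force simp: matmul.scaleR_left matmul.scaleR_right matpow_matrix_mult_commute[OF assms])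
qed

text \<open>Integrating factor: \<open>matexp (- g s *\<^sub>C M)\<close> commutes with
  \<open>M\<close>, so its product with a solution of \<open>F' = g' M F\<close> has derivative zero
  and is constant on the convex set. Invertibility of the exponential is not presupposed, because it
  is derived from this.\<close>

lemma matexp_ode_unique_aux:
  fixes F :: "complex \<Rightarrow> complex^'r^'r"
  assumes S: "convex S" "x0 \<in> S" "x \<in> S"
    and g0: "g x0 = 0" and F0: "F x0 = mat 1"
    and g: "\<And>s. s \<in> S \<Longrightarrow> (g has_field_derivative g' s) (at s)"
    and F: "\<And>s i j. s \<in> S \<Longrightarrow> ((\<lambda>s. F s $ i $ j) has_field_derivative (g' s *\<^sub>C (M ** F s)) $ i $ j) (at s)"
  shows "matexp (- g x *\<^sub>C M) ** F x = mat 1"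
proof -
  have 0: "((\<lambda>s. (matexp (- g s *\<^sub>C M) ** F s) $ i $ j) has_field_derivative 0) (at s)"
    if s: "s \<in> S" for s i j
  proof -
    have E: "((\<lambda>s. matexp (- g s *\<^sub>C M) $ i $ j) has_field_derivative
        (- g' s *\<^sub>C (M ** matexp (- g s *\<^sub>C M))) $ i $ j) (at s)" for i j
      using DERIV_chain2[OF has_derivative_matexp_entry[of M i j "- g s"] DERIV_minus[OF g[OF s]]]
      by (simp add: mult.commute)
    have comm: "matexp (- g s *\<^sub>C M) ** M = M ** matexp (- g s *\<^sub>C M)"
      by (rule matexp_commute) (simp add: cscale_matrix_mult matrix_mult_cscale)
    have "(- g' s *\<^sub>C (M ** matexp (- g s *\<^sub>C M))) ** F s + matexp (- g s *\<^sub>C M) ** (g' s *\<^sub>C (M ** F s)) = 0"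
      unfolding cscale_matrix_mult matrix_mult_cscale matrix_mul_assoc comm
      by (simp add: vec_eq_iff)
    then show ?thesis
      using has_derivative_matrix_mult_entry[OF E F[OF s], of i j] by simp
  qed
  have "(matexp (- g x *\<^sub>C M) ** F x) $ i $ j = (matexp (- g x0 *\<^sub>C M) ** F x0) $ i $ j" for i j
  proof -
    have "\<exists>c. \<forall>s\<in>S. (matexp (- g s *\<^sub>C M) ** F s) $ i $ j = c"
      by (rule has_field_derivative_zero_constant[OF S(1)])
         (rule has_field_derivative_at_within[OF 0])
    then show ?thesis using S by metis
  qed
  then have "matexp (- g x *\<^sub>C M) ** F x = matexp (- g x0 *\<^sub>C M) ** F x0"
    by (simp add: vec_eq_iff)
  also have "\<dots> = mat 1" by (simp add: F0 g0)
  finally show ?thesis .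
qed

text \<open>The exponential is itself a solution with \<open>g s = s\<close>; evaluated at
  \<open>- c\<close>, the integrating factor is its inverse.\<close>

lemma matexp_minus_inverse: "matexp (c *\<^sub>C M) ** matexp (- c *\<^sub>C M) = mat 1"
proof -
  have "matexp (- (- c) *\<^sub>C M) ** matexp ((- c) *\<^sub>C M) = mat 1"
    by (rule matexp_ode_unique_aux[where S = UNIV and ?x0.0 = 0 and F = "\<lambda>s. matexp (s *\<^sub>C M)"
          and g = "\<lambda>s. s" and g' = "\<lambda>_. 1"])
       (use has_derivative_matexp_entry[of M] in \<open>auto intro!: derivative_eq_intros simp del: nth_map_matrix\<close>)
  then show ?thesis by simp
qed

lemma matexp_ode_unique:
  fixes F :: "complex \<Rightarrow> complex^'r^'r"
  assumes "convex S" "x0 \<in> S" "x \<in> S"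
    and "g x0 = 0" and "F x0 = mat 1"
    and "\<And>s. s \<in> S \<Longrightarrow> (g has_field_derivative g' s) (at s)"
    and "\<And>s i j. s \<in> S \<Longrightarrow> ((\<lambda>s. F s $ i $ j) has_field_derivative (g' s *\<^sub>C (M ** F s)) $ i $ j) (at s)"
  shows "F x = matexp (g x *\<^sub>C M)"
proof -
  have "matexp (g x *\<^sub>C M) ** (matexp (- g x *\<^sub>C M) ** F x) = F x"
    by (simp add: matrix_mul_assoc matexp_minus_inverse)
  then show ?thesis
    by (simp add: matexp_ode_unique_aux[OF assms])
qed

text \<open>Both sides solve the same initial value problem in \<open>c\<close>. This is what later
  pulls the scalar \<open>t ^ k\<close> out of the power of \<open>t\<close> with exponent
  \<open>P + k I\<close>.\<close>

lemma matexp_add_mat: "matexp (c *\<^sub>C (M + mat a)) = exp (c * a) *\<^sub>C matexp (c *\<^sub>C M)"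
proof -
  define F where "F = (\<lambda>s. exp (s * a) *\<^sub>C matexp (s *\<^sub>C M))"
  have "F c = matexp (c *\<^sub>C (M + mat a))"
  proof (rule matexp_ode_unique[where S = UNIV and ?x0.0 = 0 and F = F and g = "\<lambda>s. s" and g' = "\<lambda>_. 1"])
    show "F 0 = mat 1" by (simp add: F_def)
    show "((\<lambda>s. F s $ i $ j) has_field_derivative (1 *\<^sub>C ((M + mat a) ** F s)) $ i $ j) (at s)" for s i j
      unfolding F_def
      by (auto intro!: derivative_eq_intros has_derivative_matexp_entry
          simp: matmul.add_left matrix_mult_cscale mat_matrix_mult algebra_simps)
  qed auto
  then show ?thesis by (simp add: F_def)
qed

section \<open>The binomial series\<close>

text \<open>The definition appends factors on the right, while the differential equation of the
  binomial series needs \<open>M\<close> on the left.\<close>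

lemma matpochhammer_commute: "matpochhammer M n ** M = M ** matpochhammer M n"
proof (induction n)
  case (Suc n)
  have "(M + mat (of_nat n)) ** M = M ** (M + mat (of_nat n))"
    by (simp add: matmul.add_left matmul.add_right mat_matrix_mult matrix_mult_mat)
  then show ?case
    by (simp, metis Suc.IH matrix_mul_assoc)
qed simp

text \<open>Ratio test: each term is at most \<open>r * (b + n) / (n + 1)\<close> times the one
  before, and this factor tends to \<open>r < 1\<close>.\<close>

lemma summable_matpochhammer:
  fixes M :: "complex^'r^'r"
  assumes "0 \<le> r" "r < 1"
  shows "summable (\<lambda>n. norm (matpochhammer M n) / fact n * r ^ n)"
proof -
  obtain K where K: "K > 0" "\<And>(P :: complex^'r^'r) (Q :: complex^'r^'r). norm (P ** Q) \<le> norm P * norm Q * K"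
    using matmul.pos_bounded by blast
  define b where "b = norm M * K"
  have b: "b \<ge> 0" using K by (simp add: b_def)
  \<comment> \<open>\<open>c\<close> is the midpoint of \<open>r\<close> and 1, and from
    \<open>N\<close> on \<open>r * b \<le> (c - r) * n\<close>, which gives
    \<open>r * (b + n) \<le> c * (n + 1)\<close>.\<close>
  define c where "c = (1 + r) / 2"
  define N where "N = nat \<lceil>r * b / (c - r)\<rceil>"
  have step: "norm (matpochhammer M (Suc n)) \<le> (b + n) * norm (matpochhammer M n)" for n
  proof -
    have "norm (matpochhammer M (Suc n)) \<le> norm (matpochhammer M n ** M) + norm (of_nat n *\<^sub>C matpochhammer M n)"
      by (simp add: matmul.add_right matrix_mult_mat norm_triangle_ineq)
    also have "\<dots> \<le> norm (matpochhammer M n) * norm M * K + n * norm (matpochhammer M n)"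
      using K(2) by (intro add_mono) (simp_all add: norm_cscale)
    finally show ?thesis by (simp add: b_def algebra_simps)
  qed
  show ?thesis
  proof (rule summable_ratio_test[where c = c and N = N])
    show "c < 1" using assms by (simp add: c_def)
    fix n assume "N \<le> n"
    then have "r * b / (c - r) \<le> n" by (simp add: N_def nat_le_iff ceiling_le_iff)
    then have "r * b \<le> (c - r) * n" using assms by (simp add: c_def divide_simps mult.commute)
    moreover have "c \<ge> 0" using assms by (simp add: c_def)
    ultimately have *: "r * (b + n) \<le> c * (n + 1)" by (simp add: algebra_simps)
    have "norm (matpochhammer M (Suc n)) / fact (Suc n) * r ^ Suc n
        \<le> (b + n) * norm (matpochhammer M n) / fact (Suc n) * r ^ Suc n"
      using assms by (intro mult_right_mono divide_right_mono step) auto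
    also have "\<dots> = r * (b + n) * (norm (matpochhammer M n) / (fact n * (n + 1)) * r ^ n)"
      by (simp add: field_simps)
    also have "\<dots> \<le> c * (n + 1) * (norm (matpochhammer M n) / (fact n * (n + 1)) * r ^ n)"
      using assms by (intro mult_right_mono *) auto
    also have "\<dots> = c * (norm (matpochhammer M n) / fact n * r ^ n)"
    proof -
      have "fact n + fact n * real n > 0" by (intro add_pos_nonneg) auto
      then show ?thesis by (simp add: field_simps)
    qed
    finally show "norm (norm (matpochhammer M (Suc n)) / fact (Suc n) * r ^ Suc n)
        \<le> c * norm (norm (matpochhammer M n) / fact n * r ^ n)"
      using assms by simp
  qed
qed

lemma summable_matpochhammer_entry:
  assumes "norm s < 1"
  shows "summable (\<lambda>n. matpochhammer M n $ i $ j / fact n * s ^ n)"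
proof (rule summable_comparison_test')
  show "summable (\<lambda>n. norm (matpochhammer M n) / fact n * norm s ^ n)"
    using assms by (intro summable_matpochhammer) auto
  show "norm (matpochhammer M n $ i $ j / fact n * s ^ n) \<le> norm (matpochhammer M n) / fact n * norm s ^ n"
    if "n \<ge> 0" for n
    unfolding norm_mult norm_divide norm_power norm_fact
    by (intro mult_right_mono divide_right_mono norm_entry_le) auto
qed

text \<open>On the unit disc the binomial series solves \<open>(1 - s) F' = M F\<close> with
  \<open>F 0 = I\<close>. Uniqueness with \<open>g s = - Ln (1 - s)\<close> identifies it with the
  exponential.\<close>

lemma one_minus_powr_neg_entry:
  assumes "norm s < 1"
  shows "one_minus_powr_neg s M $ i $ j = (\<Sum>n. matpochhammer M n $ i $ j / fact n * s ^ n)"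
proof -
  define a where "a n i j = matpochhammer M n $ i $ j / fact n" for n i j
  define F where "F s = (\<chi> i j. \<Sum>n. a n i j * s ^ n)" for s
  have sm: "summable (\<lambda>n. a n i j * x ^ n)" if "norm x < 1" for x i j
    unfolding a_def by (rule summable_matpochhammer_entry[OF that])
  have "F s = matexp (- Ln (1 - s) *\<^sub>C M)"
  proof (rule matexp_ode_unique[where S = "ball 0 1" and ?x0.0 = 0 and F = F
        and g = "\<lambda>s. - Ln (1 - s)" and g' = "\<lambda>s. 1 / (1 - s)"])
    have "F 0 $ i $ j = a 0 i j" for i j
      by (simp add: F_def)
    then show "F 0 = mat 1"
      by (simp add: vec_eq_iff a_def)
    show "s \<in> ball 0 1" using assms by simp
    fix s :: complex assume "s \<in> ball 0 1"
    then have s: "norm s < 1" by simp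
    then have s1: "s \<noteq> 1" by auto
    \<comment> \<open>This keeps \<open>1 - s\<close> off the branch cut of
      \<open>Ln\<close>.\<close>
    have "Re s < 1" using s complex_Re_le_cmod[of s] by linarith
    then have "1 - s \<notin> \<real>\<^sub>\<le>\<^sub>0" by (auto simp: complex_nonpos_Reals_iff)
    then show "((\<lambda>s. - Ln (1 - s)) has_field_derivative 1 / (1 - s)) (at s)"
      by (auto intro!: derivative_eq_intros simp: inverse_eq_divide)
    fix i j
    define D where "D = diffs (\<lambda>n. a n i j)"
    have D: "D n = of_nat (Suc n) * a (Suc n) i j" for n
      by (simp add: D_def diffs_def)
    \<comment> \<open>The differential equation read off on coefficients:
      \<open>(n + 1) a (n + 1) = M a n + n a n\<close>.\<close>
    have D': "D n = (\<Sum>k\<in>UNIV. M $ i $ k * a n k j) + of_nat n * a n i j" for n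
    proof -
      have "D n = matpochhammer M (Suc n) $ i $ j / fact n"
        by (simp add: D a_def del: matpochhammer.simps of_nat_Suc)
      also have "matpochhammer M (Suc n) = M ** matpochhammer M n + of_nat n *\<^sub>C matpochhammer M n"
        by (simp add: matmul.add_right matrix_mult_mat matpochhammer_commute)
      finally show ?thesis
        by (simp add: a_def matrix_matrix_mult_def add_divide_distrib sum_divide_distrib)
    qed
    define T where "T = (\<Sum>n. D n * s ^ n)"
    have T: "(\<lambda>n. D n * s ^ n) sums T"
      unfolding T_def D_def by (intro summable_sums termdiff_converges[OF s] sm)
    \<comment> \<open>Multiplication by \<open>s\<close> shifts the index, and the term at 0
      vanishes, so \<open>s * T\<close> is the series of \<open>n a n s ^ n\<close>. Subtracting it
      from \<open>T\<close> leaves the entry of \<open>M F\<close>.\<close>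
    have "(\<lambda>n. of_nat (Suc n) * a (Suc n) i j * s ^ Suc n) sums (s * T)"
      using sums_mult[OF T, of s] by (simp add: D algebra_simps)
    then have "(\<lambda>n. of_nat n * a n i j * s ^ n) sums (s * T)"
      by (subst (asm) sums_Suc_iff) simp
    from sums_diff[OF T this]
    have "(\<lambda>n. \<Sum>k\<in>UNIV. M $ i $ k * (a n k j * s ^ n)) sums (T - s * T)"
      by (simp add: D' algebra_simps sum_distrib_left)
    moreover have "(\<lambda>n. \<Sum>k\<in>UNIV. M $ i $ k * (a n k j * s ^ n)) sums (\<Sum>k\<in>UNIV. M $ i $ k * F s $ k $ j)"
      by (intro sums_sum sums_mult) (simp add: F_def summable_sums sm s)
    ultimately have "T - s * T = (\<Sum>k\<in>UNIV. M $ i $ k * F s $ k $ j)"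
      by (rule sums_unique2)
    then have "(1 - s) * T = (M ** F s) $ i $ j"
      by (simp add: matrix_matrix_mult_def algebra_simps)
    then have "T = ((1 / (1 - s)) *\<^sub>C (M ** F s)) $ i $ j"
      using s1 by (simp add: field_simps)
    moreover have "((\<lambda>x. \<Sum>n. a n i j * x ^ n) has_field_derivative T) (at s)"
      unfolding T_def D_def by (rule termdiffs_strong'[OF sm s])
    ultimately show "((\<lambda>s. F s $ i $ j) has_field_derivative ((1 / (1 - s)) *\<^sub>C (M ** F s)) $ i $ j) (at s)"
      by (simp add: F_def)
  qed auto
  moreover have "- (Ln (1 - s) *\<^sub>C M) = - Ln (1 - s) *\<^sub>C M" by (simp add: vec_eq_iff)
  ultimately have "one_minus_powr_neg s M = F s" by (simp add: one_minus_powr_neg_def)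
  then show ?thesis by (simp add: F_def a_def)
qed

section \<open>Exponential decay for positive stable matrices\<close>

text \<open>Decay is required along the orbit of a single vector, with constants depending on it, so
  that it can be passed from \<open>p(X) v\<close> to \<open>v\<close> one linear factor at a
  time.\<close>

definition exp_decay :: "complex^'r^'r \<Rightarrow> complex^'r \<Rightarrow> bool" where
  "exp_decay X v \<longleftrightarrow> (\<exists>K c. c > 0 \<and>
     (\<forall>t\<ge>0. \<forall>i. norm ((matexp (- of_real t *\<^sub>C X) *v v) $ i) \<le> K * exp (- c * t)))"

text \<open>\<open>N\<close> commutes with the exponential, so the orbit of \<open>N v\<close> is
  the image under \<open>N\<close> of the orbit of \<open>v\<close>.\<close>

lemma exp_decay_matrix_vector_mult:
  assumes "exp_decay X v" and comm: "N ** X = X ** N"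
  shows "exp_decay X (N *v v)"
proof -
  from assms(1) obtain K c where c: "c > 0"
    and K: "\<And>t i. t \<ge> 0 \<Longrightarrow> norm ((matexp (- of_real t *\<^sub>C X) *v v) $ i) \<le> K * exp (- c * t)"
    by (auto simp: exp_decay_def)
  define L where "L = (\<Sum>i\<in>UNIV. \<Sum>k\<in>UNIV. norm (N $ i $ k))"
  have "norm ((matexp (- of_real t *\<^sub>C X) *v (N *v v)) $ i) \<le> L * K * exp (- c * t)"
    if t: "t \<ge> 0" for t i
  proof -
    define w where "w = matexp (- of_real t *\<^sub>C X) *v v"
    have "matexp (- of_real t *\<^sub>C X) ** N = N ** matexp (- of_real t *\<^sub>C X)"
      by (rule matexp_commute) (simp add: cscale_matrix_mult matrix_mult_cscale comm)
    then have "matexp (- of_real t *\<^sub>C X) *v (N *v v) = N *v w"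
      by (simp add: w_def matrix_vector_mul_assoc)
    then have "norm ((matexp (- of_real t *\<^sub>C X) *v (N *v v)) $ i) \<le> (\<Sum>k\<in>UNIV. norm (N $ i $ k * w $ k))"
      by (simp add: matrix_vector_mult_def norm_sum)
    also have "\<dots> \<le> (\<Sum>k\<in>UNIV. norm (N $ i $ k) * (K * exp (- c * t)))"
      unfolding norm_mult w_def by (intro sum_mono mult_left_mono K t) auto
    also have "\<dots> = (\<Sum>k\<in>UNIV. norm (N $ i $ k)) * (K * exp (- c * t))"
      by (simp add: sum_distrib_right)
    also have "\<dots> \<le> L * (K * exp (- c * t))"
    proof (rule mult_right_mono)
      show "(\<Sum>k\<in>UNIV. norm (N $ i $ k)) \<le> L"
        unfolding L_def by (rule member_le_sum) (auto intro: sum_nonneg)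
      show "0 \<le> K * exp (- c * t)"
        using K[OF t, of i] norm_ge_zero order_trans by blast
    qed
    finally show ?thesis by (simp add: mult.assoc)
  qed
  then show ?thesis using c unfolding exp_decay_def by blast
qed

lemma exp_decay_scale:
  assumes "exp_decay X v" shows "exp_decay X (a *s v)"
proof -
  have "mat a *v v = a *s v"
    by (simp add: vec_eq_iff matrix_vector_mult_def mat_def if_distrib[of "\<lambda>x. x * _"] cong: if_cong)
  then show ?thesis
    using exp_decay_matrix_vector_mult[OF assms, of "mat a"] by (simp add: mat_matrix_mult matrix_mult_mat)
qed

lemma exp_decay_zero: "exp_decay X 0"
  unfolding exp_decay_def by (rule exI[of _ 0], rule exI[of _ 1]) simp

text \<open>Variation of constants: \<open>exp (l t) exp (- t X) v\<close> has derivative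
  \<open>- exp (l t) exp (- t X) w\<close> for \<open>w = (X - l) v\<close>.\<close>

lemma exp_decay_of_eigenvalue:
  assumes w: "exp_decay X (X *v v - l *s v)" and l: "0 < Re l"
  shows "exp_decay X v"
proof -
  define w where "w = X *v v - l *s v"
  from w obtain K c0 where c0: "c0 > 0"
    and K0: "\<And>t i. t \<ge> 0 \<Longrightarrow> norm ((matexp (- of_real t *\<^sub>C X) *v w) $ i) \<le> K * exp (- c0 * t)"
    by (auto simp: exp_decay_def w_def)
  \<comment> \<open>\<open>exp_decay\<close> prescribes no sign for \<open>K\<close>; the bound at
    \<open>t = 0\<close> forces \<open>K \<ge> 0\<close>.\<close>
  have "norm ((matexp (- of_real 0 *\<^sub>C X) *v w) $ undefined) \<le> K"
    using K0[of 0 undefined] by simp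
  then have Kpos: "K \<ge> 0" using norm_ge_zero order_trans by blast
  define a where "a = Re l"
  \<comment> \<open>\<open>c \<le> c0\<close> preserves the bound for \<open>w\<close>, and
    \<open>c \<le> a / 2\<close> keeps \<open>a - c\<close>, the divisor in \<open>\<phi>\<close>,
    positive.\<close>
  define c where "c = min c0 (a / 2)"
  have c: "0 < c" "c < a" using c0 l by (auto simp: c_def a_def)
  have K: "norm ((matexp (- of_real t *\<^sub>C X) *v w) $ i) \<le> K * exp (- c * t)" if "t \<ge> 0" for t i
  proof -
    have "exp (- c0 * t) \<le> exp (- c * t)"
      using that by (auto simp: c_def intro!: mult_right_mono)
    then show ?thesis using K0[OF that, of i] Kpos by (meson mult_left_mono order_trans)
  qed
  define Y where "Y i s = exp (l * s) * (matexp (- s *\<^sub>C X) *v v) $ i" for i s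
  have dY: "(Y i has_field_derivative - (exp (l * s) * (matexp (- s *\<^sub>C X) *v w) $ i)) (at s)" for i s
  proof -
    have E: "((\<lambda>s. matexp (- s *\<^sub>C X) $ i $ j) has_field_derivative
        - (X ** matexp (- s *\<^sub>C X)) $ i $ j) (at s)" for i j
      using DERIV_chain2[OF has_derivative_matexp_entry[of X i j "- s"] DERIV_minus[OF DERIV_ident]]
      by simp
    have XE: "X ** matexp (- s *\<^sub>C X) = matexp (- s *\<^sub>C X) ** X"
      by (rule matexp_commute[symmetric]) (simp add: cscale_matrix_mult matrix_mult_cscale)
    have Ev: "((\<lambda>s. (matexp (- s *\<^sub>C X) *v v) $ i) has_field_derivative
        - (matexp (- s *\<^sub>C X) *v (X *v v)) $ i) (at s)"
    proof -
      have "((\<lambda>s. \<Sum>k\<in>UNIV. matexp (- s *\<^sub>C X) $ i $ k * v $ k) has_field_derivative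
          (\<Sum>k\<in>UNIV. - (X ** matexp (- s *\<^sub>C X)) $ i $ k * v $ k)) (at s)"
        by (intro DERIV_sum DERIV_cmult_right E)
      also have "(\<Sum>k\<in>UNIV. - (X ** matexp (- s *\<^sub>C X)) $ i $ k * v $ k)
          = - (matexp (- s *\<^sub>C X) *v (X *v v)) $ i"
        by (simp add: matrix_vector_mul_assoc XE) (simp add: matrix_vector_mult_def sum_negf)
      finally show ?thesis by (simp only: matrix_vector_mult_def vec_lambda_beta)
    qed
    have "((\<lambda>s. exp (l * s)) has_field_derivative exp (l * s) * l) (at s)"
      by (auto intro!: derivative_eq_intros)
    from DERIV_mult[OF this Ev] show ?thesis
      by (simp add: Y_def[abs_def] w_def matrix_vector_mult_diff_distrib vector_scalar_commute algebra_simps)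
  qed
  \<comment> \<open>A primitive of \<open>K * exp ((a - c) * t)\<close>, which bounds the norm of
    the derivative of \<open>Y\<close>; by the mean value inequality \<open>Y\<close> then grows no
    faster than \<open>\<phi>\<close>.\<close>
  define \<phi> where "\<phi> t = K / (a - c) * exp ((a - c) * t)" for t
  have "norm ((matexp (- of_real t *\<^sub>C X) *v v) $ i) \<le> (norm v + K / (a - c)) * exp (- c * t)"
    if t: "t \<ge> 0" for t i
  proof -
    have "norm (Y i (of_real t) - Y i (of_real 0)) \<le> \<phi> t - \<phi> 0"
    proof (cases "t = 0")
      case False
      have vd: "((\<lambda>t. Y i (of_real t)) has_vector_derivative
          - (exp (l * of_real x) * (matexp (- of_real x *\<^sub>C X) *v w) $ i)) (at x)" for x
        by (rule has_vector_derivative_real_field) (rule dY)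
      show ?thesis
      proof (rule differentiable_bound_general)
        show "0 < t" using False t by simp
        show "continuous_on {0..t} (\<lambda>t. Y i (of_real t))"
          using vd by (meson continuous_at_imp_continuous_on has_vector_derivative_continuous)
        show "continuous_on {0..t} \<phi>"
          unfolding \<phi>_def by (intro continuous_intros)
        show "(\<phi> has_vector_derivative K * exp ((a - c) * x)) (at x)" for x
          unfolding \<phi>_def has_real_derivative_iff_has_vector_derivative[symmetric]
          using c by (auto intro!: derivative_eq_intros)
        fix x :: real assume x: "0 < x"
        have "norm (exp (l * of_real x)) = exp (a * x)"
          by (simp add: norm_exp_eq_Re a_def)
        then have "norm (- (exp (l * of_real x) * (matexp (- of_real x *\<^sub>C X) *v w) $ i))
            \<le> exp (a * x) * (K * exp (- c * x))"
          using K[of x i] x by (simp add: norm_mult)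
        then show "norm (- (exp (l * of_real x) * (matexp (- of_real x *\<^sub>C X) *v w) $ i))
            \<le> K * exp ((a - c) * x)"
          by (simp add: left_diff_distrib exp_diff exp_minus field_simps)
      qed (rule vd)
    qed simp
    moreover have "norm (Y i (of_real 0)) \<le> norm v"
      by (simp add: Y_def Finite_Cartesian_Product.norm_nth_le)
    moreover have "\<phi> 0 \<ge> 0" using c Kpos by (simp add: \<phi>_def)
    moreover have "norm (Y i (of_real t)) \<le> norm (Y i (of_real t) - Y i (of_real 0)) + norm (Y i (of_real 0))"
      using norm_triangle_sub by (simp add: add.commute norm_triangle_sub)
    ultimately have "norm (Y i (of_real t)) \<le> norm v + \<phi> t"
      by linarith
    moreover have "norm (Y i (of_real t)) = exp (a * t) * norm ((matexp (- of_real t *\<^sub>C X) *v v) $ i)"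
      by (simp add: Y_def norm_mult norm_exp_eq_Re a_def)
    \<comment> \<open>Removing the factor \<open>exp (a * t)\<close> leaves the constant decaying at
      rate \<open>a > c\<close> and \<open>\<phi> t\<close> at rate \<open>c\<close>.\<close>
    ultimately have "exp (- a * t) * (exp (a * t) * norm ((matexp (- of_real t *\<^sub>C X) *v v) $ i))
        \<le> exp (- a * t) * (norm v + \<phi> t)"
      by (intro mult_left_mono) auto
    also have "\<dots> = exp (- a * t) * norm v + K / (a - c) * exp (- c * t)"
    proof -
      have "exp (- a * t) * exp ((a - c) * t) = exp (- c * t)"
        unfolding exp_add[symmetric] by (simp add: algebra_simps)
      then show ?thesis by (simp add: \<phi>_def distrib_left)
    qed
    also have "\<dots> \<le> exp (- c * t) * norm v + K / (a - c) * exp (- c * t)"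
    proof (intro add_right_mono mult_right_mono)
      show "exp (- a * t) \<le> exp (- c * t)" using t c by (simp add: mult_right_mono)
    qed simp
    also have "\<dots> = (norm v + K / (a - c)) * exp (- c * t)"
      by (simp add: distrib_right)
    also have "exp (- a * t) * (exp (a * t) * norm ((matexp (- of_real t *\<^sub>C X) *v v) $ i))
        = norm ((matexp (- of_real t *\<^sub>C X) *v v) $ i)"
      by (simp add: exp_minus)
    finally show ?thesis .
  qed
  then show ?thesis using c(1) unfolding exp_decay_def by blast
qed

text \<open>\<open>X - l\<close> is invertible and its inverse commutes with \<open>X\<close>, so
  \<open>v\<close> is the image of \<open>X v - l v\<close> under a matrix that preserves
  decay.\<close>

lemma exp_decay_of_not_eigenvalue:
  assumes w: "exp_decay X (X *v v - l *s v)" and l: "\<not> mat_eigenvalue X l"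
  shows "exp_decay X v"
proof -
  define Z where "Z = X - mat l"
  have Z: "Z *v u = X *v u - l *s u" for u
    by (simp add: Z_def matrix_vector_mult_diff_rdistrib)
       (simp add: vec_eq_iff matrix_vector_mult_def mat_def if_distrib[of "\<lambda>x. x * _"] cong: if_cong)
  have "inj ((*v) Z)"
    unfolding vec.inj_iff_eq_0 using l by (auto simp: mat_eigenvalue_def Z)
  then obtain N where N: "N ** Z = mat 1"
    unfolding matrix_left_invertible_injective[symmetric] by blast
  then have N': "Z ** N = mat 1" by (simp add: matrix_left_right_inverse)
  have "Z ** X = X ** Z"
    by (simp add: Z_def matmul.diff_left matmul.diff_right mat_matrix_mult matrix_mult_mat)
  \<comment> \<open>Multiplying \<open>Z X = X Z\<close> by \<open>N\<close> on both sides transfers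
    the commutation to the inverse.\<close>
  then have "N ** (Z ** X) ** N = N ** (X ** Z) ** N" by simp
  then have "X ** N = N ** X"
    by (metis N N' matrix_mul_assoc matrix_mul_lid matrix_mul_rid)
  then have "exp_decay X (N *v (Z *v v))"
    using w by (intro exp_decay_matrix_vector_mult[of X "Z *v v"]) (simp_all add: Z)
  then show ?thesis by (simp add: matrix_vector_mul_assoc N)
qed

section \<open>Vectors of the form \<open>p(X) v\<close> and annihilating polynomials\<close>

definition poly_vec :: "complex^'r^'r \<Rightarrow> complex poly \<Rightarrow> complex^'r \<Rightarrow> complex^'r" where
  "poly_vec X p v = (\<Sum>i\<le>degree p. coeff p i *s (matpow X i *v v))"

lemma poly_vec_bound:
  assumes "degree p \<le> n"
  shows "poly_vec X p v = (\<Sum>i\<le>n. coeff p i *s (matpow X i *v v))"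
  unfolding poly_vec_def using assms
  by (intro sum.mono_neutral_left) (auto simp: coeff_eq_0)

text \<open>Multiplication by the variable shifts coefficients and so raises each power of
  \<open>X\<close> by one. The right side has the form \<open>X u - l u\<close> that both decay
  criteria take.\<close>

lemma poly_vec_linear_factor:
  "poly_vec X ([:- l, 1:] * q) v = X *v poly_vec X q v - l *s poly_vec X q v"
proof -
  define n where "n = degree q"
  define u where "u i = matpow X i *v v" for i
  have deg: "degree ([:- l, 1:] * q) \<le> Suc n"
    using degree_mult_le[of "[:- l, 1:]" q] by (simp add: n_def)
  have "poly_vec X ([:- l, 1:] * q) v = (\<Sum>i\<le>Suc n. (coeff (pCons 0 q) i - l * coeff q i) *s u i)"
    unfolding poly_vec_bound[OF deg] u_def by (simp add: mult_pCons_left)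
  also have "\<dots> = (\<Sum>i\<le>Suc n. coeff (pCons 0 q) i *s u i) - (\<Sum>i\<le>Suc n. l *s (coeff q i *s u i))"
    by (simp only: vector_sub_rdistrib vector_smult_assoc sum_subtractf)
  also have "(\<Sum>i\<le>Suc n. coeff (pCons 0 q) i *s u i) = (\<Sum>i\<le>n. coeff q i *s u (Suc i))"
    by (subst sum.atMost_Suc_shift) simp
  also have "\<dots> = X *v poly_vec X q v"
    unfolding poly_vec_def n_def[symmetric] u_def
    by (simp add: vec.sum matrix_vector_mul_assoc vector_scalar_commute)
  also have "(\<Sum>i\<le>Suc n. l *s (coeff q i *s u i)) = l *s poly_vec X q v"
    unfolding poly_vec_bound[of q "Suc n", OF le_SucI[OF eq_refl[OF n_def[symmetric]]]] u_def
    by (simp add: vec.scale_sum_right)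
  finally show ?thesis .
qed

text \<open>Split off a root \<open>l\<close> of \<open>p\<close> and induct on the degree. If
  \<open>l\<close> is an eigenvalue, stability gives \<open>Re l > 0\<close> and variation of
  constants removes the factor; otherwise the factor is invertible.\<close>

lemma exp_decay_of_poly_vec:
  assumes stable: "positive_stable X"
  shows "p \<noteq> 0 \<Longrightarrow> exp_decay X (poly_vec X p v) \<Longrightarrow> exp_decay X v"
proof (induction "degree p" arbitrary: p)
  case 0
  then obtain a where a: "p = [:a:]" "a \<noteq> 0" by (metis degree_eq_zeroE pCons_0_0)
  then have "poly_vec X p v = a *s v" by (simp add: poly_vec_def)
  then show ?case
    using exp_decay_scale[of X "a *s v" "1 / a"] 0 a by (simp add: vector_smult_assoc)
next
  case (Suc n)
  then have "\<not> constant (poly p)" by (simp add: constant_degree)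
  then obtain l where "poly p l = 0" using fundamental_theorem_of_algebra by blast
  then obtain q where q: "p = [:- l, 1:] * q" by (auto simp: poly_eq_0_iff_dvd)
  with Suc have "q \<noteq> 0" by auto
  then have "degree p = Suc (degree q)" unfolding q by (subst degree_mult_eq) auto
  then have "n = degree q" using Suc by simp
  have "exp_decay X (X *v poly_vec X q v - l *s poly_vec X q v)"
    using Suc.prems(2) unfolding q poly_vec_linear_factor .
  then have "exp_decay X (poly_vec X q v)"
    using stable exp_decay_of_eigenvalue exp_decay_of_not_eigenvalue
    unfolding positive_stable_def by blast
  then show ?case using Suc.hyps(1)[OF \<open>n = degree q\<close> \<open>q \<noteq> 0\<close>] by simp
qed

text \<open>The \<open>CARD('r) + 1\<close> vectors \<open>v, X v, X^2 v, ...\<close> satisfy a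
  nontrivial linear relation, whose coefficients form \<open>p\<close>. Dependence is a notion for
  sets, so a repeated vector is treated separately, with coefficients 1 and -1.\<close>

lemma exists_annihilating_poly:
  fixes X :: "complex^'r^'r"
  shows "\<exists>p. p \<noteq> 0 \<and> poly_vec X p v = 0"
proof -
  define n where "n = CARD('r)"
  define u where "u i = matpow X i *v v" for i
  obtain f where f: "(\<Sum>i\<le>n. f i *s u i) = 0" "\<exists>i\<le>n. f i \<noteq> 0"
  proof (cases "inj_on u {..n}")
    case True
    have "vec.dim (u ` {..n}) \<le> CARD('r)"
      using vec.dim_subset[OF subset_UNIV, of "u ` {..n}"] unfolding vec_dim_card .
    then have "vec.dependent (u ` {..n})"
      using True by (intro vec.dependent_biggerset_general) (simp add: card_image n_def)
    then obtain g where "\<exists>x\<in>u ` {..n}. g x \<noteq> 0" "(\<Sum>x\<in>u ` {..n}. g x *s x) = 0"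
      by (auto simp: vec.dependent_finite)
    then show ?thesis
      using that[of "g \<circ> u"] True by (auto simp: sum.reindex)
  next
    case False
    then obtain i j where ij: "i \<le> n" "j \<le> n" "i \<noteq> j" "u i = u j" by (auto simp: inj_on_def)
    define f :: "nat \<Rightarrow> complex" where "f k = (if k = i then 1 else if k = j then - 1 else 0)" for k
    have "(\<Sum>k\<le>n. f k *s u k) = (\<Sum>k\<in>{i, j}. f k *s u k)"
      using ij by (intro sum.mono_neutral_right) (auto simp: f_def)
    also have "\<dots> = 0" using ij by (simp add: f_def vec_eq_iff)
    finally have "(\<Sum>k\<le>n. f k *s u k) = 0" .
    moreover have "f i \<noteq> 0" by (simp add: f_def)
    ultimately show ?thesis using that ij(1) by blast
  qed
  define p where "p = (\<Sum>i\<le>n. monom (f i) i)"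
  have coeff: "coeff p i = (if i \<le> n then f i else 0)" for i
    by (simp add: p_def coeff_sum)
  then have "degree p \<le> n" by (intro degree_le) simp
  then have "poly_vec X p v = 0"
    using f by (simp add: poly_vec_bound coeff u_def)
  moreover have "p \<noteq> 0" using f(2) coeff by (metis coeff_0)
  ultimately show ?thesis by blast
qed

text \<open>Every orbit decays, since some nonzero \<open>p\<close> has \<open>p(X) v = 0\<close>.
  The columns of the exponential are the orbits of the unit vectors, and exponential decay is faster
  than any power.\<close>

lemma norm_matexp_neg_le_power:
  fixes X :: "complex^'r^'r"
  assumes "positive_stable X"
  shows "\<exists>K\<ge>0. \<forall>t>0. norm (matexp (- t *\<^sub>R X)) \<le> K / t ^ n"
proof -
  have "exp_decay X v" for v
    using exists_annihilating_poly exp_decay_of_poly_vec[OF assms] exp_decay_zero by metis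
  then have "\<forall>j. \<exists>K c. c > 0 \<and>
      (\<forall>t\<ge>0. \<forall>i. norm ((matexp (- of_real t *\<^sub>C X) *v axis j 1) $ i) \<le> K * exp (- c * t))"
    unfolding exp_decay_def by blast
  then obtain K c where Kc: "\<forall>j. 0 < c j \<and>
      (\<forall>t\<ge>0. \<forall>i. norm ((matexp (- of_real t *\<^sub>C X) *v axis j 1) $ i) \<le> K j * exp (- c j * t))"
    unfolding choice_iff by blast
  then have c: "c j > 0" for j by blast
  have mv: "(M *v axis j 1) $ i = M $ i $ j" for M :: "complex^'r^'r" and i j
    by (simp add: matrix_vector_mult_def axis_def if_distrib[of "\<lambda>x. _ * x"] cong: if_cong)
  have K: "norm (matexp (- of_real t *\<^sub>C X) $ i $ j) \<le> K j * exp (- c j * t)"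
    if "t \<ge> 0" for t i j
    using Kc that unfolding mv by blast
  have K0: "K j \<ge> 0" for j
    using order_trans[OF norm_ge_zero K[of 0 undefined j]] by simp
  define L where "L = (\<Sum>j\<in>UNIV. K j * fact n / c j ^ n)"
  have "norm (matexp (- t *\<^sub>R X)) \<le> CARD('r) * CARD('r) * (L / t ^ n)" if t: "t > 0" for t
  proof (rule norm_le_of_entries_le)
    fix i j
    \<comment> \<open>All terms of the exponential series are nonnegative here, so a single one
      bounds it from below.\<close>
    have "(c j * t) ^ n / fact n \<le> exp (c j * t)"
    proof -
      have "(\<lambda>k. (c j * t) ^ k / fact k) sums exp (c j * t)"
        using exp_converges[of "c j * t"] by (simp add: divide_inverse mult.commute)
      then show ?thesis
        using sum_le_suminf[of "\<lambda>k. (c j * t) ^ k / fact k" "{n}"] c[of j] t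
        by (simp add: sums_iff)
    qed
    then have "exp (- c j * t) \<le> fact n / (c j * t) ^ n"
      using c[of j] t by (simp add: exp_minus divide_simps mult.commute)
    then have "K j * exp (- c j * t) \<le> K j * (fact n / (c j * t) ^ n)"
      by (rule mult_left_mono) (rule K0)
    also have "\<dots> = K j * fact n / c j ^ n / t ^ n"
      by (simp add: power_mult_distrib)
    also have "\<dots> \<le> L / t ^ n"
      unfolding L_def using t c K0 by (intro divide_right_mono member_le_sum) (auto simp: less_imp_le)
    finally show "norm (matexp (- t *\<^sub>R X) $ i $ j) \<le> L / t ^ n"
      using K[of t i j] t cscale_of_real[of "- t" X] by simp
  qed
  moreover have "L \<ge> 0" unfolding L_def using K0 c by (intro sum_nonneg) (simp add: less_imp_le)
  ultimately show ?thesis by (intro exI[of _ "CARD('r) * CARD('r) * L"]) auto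
qed

section \<open>The beta kernel\<close>

lemma continuous_on_matexp_scaleR:
  fixes g :: "real \<Rightarrow> real"
  assumes "continuous_on S g"
  shows "continuous_on S (\<lambda>t. matexp (g t *\<^sub>R M))"
proof -
  have "continuous_on UNIV (\<lambda>c. matexp (c *\<^sub>C M))"
    unfolding continuous_on_def
    by (intro ballI vec_tendstoI) (rule has_derivative_matexp_entry[THEN DERIV_isCont, unfolded isCont_def])
  from continuous_on_compose2[OF this continuous_on_of_real[OF assms]] show ?thesis
    by (simp add: cscale_of_real)
qed

lemma set_integrable_bounded_continuous:
  fixes f :: "real \<Rightarrow> 'a :: {banach, second_countable_topology}"
  assumes "continuous_on {0<..<1} f" and "\<And>u. u \<in> {0<..<1} \<Longrightarrow> norm (f u) \<le> K"
  shows "set_integrable lborel {0<..<1} f"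
proof (rule set_integrable_bound[of _ _ "\<lambda>_. K"])
  show "set_integrable lborel {0<..<1::real} (\<lambda>_. K)"
    by (simp add: set_integrable_def)
  show "set_borel_measurable lborel {0<..<1} f"
    using borel_measurable_continuous_on_indicator[OF _ assms(1)] by (simp add: set_borel_measurable_def)
  have "norm (f u) \<le> norm K" if "u \<in> {0<..<1}" for u
    using assms(2)[OF that] by simp
  then show "AE u in lborel. u \<in> {0<..<1} \<longrightarrow> norm (f u) \<le> norm K" by blast
qed

text \<open>The norm of \<open>ln t *\<^sub>R M\<close> is \<open>- ln t * norm M\<close>, so the
  exponential bound turns into a negative power of \<open>t\<close>. A crude exponent is enough, as
  it is cancelled in the kernel.\<close>

lemma norm_matpowr_le:
  assumes t: "0 < t" "t < 1" and n: "CARD('r) * norm (M :: complex^'r^'r) \<le> real n"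
  shows "norm (matpowr t M) \<le> (CARD('r) * CARD('r)) / t ^ n"
proof -
  have "CARD('r) * norm (ln t *\<^sub>R M) = - ln t * (CARD('r) * norm M)"
    using t by simp
  also have "\<dots> \<le> - ln t * n" using t by (intro mult_left_mono n) simp
  finally have "exp (CARD('r) * norm (ln t *\<^sub>R M)) \<le> exp (- ln t * n)" by simp
  also have "\<dots> = 1 / t ^ n"
    using t exp_of_nat_mult[of n "ln t"] by (simp add: exp_minus inverse_eq_divide mult.commute)
  finally have "CARD('r) * CARD('r) * exp (CARD('r) * norm (ln t *\<^sub>R M))
      \<le> CARD('r) * CARD('r) * (1 / t ^ n)"
    by (intro mult_left_mono) auto
  with norm_matexp_le[of "ln t *\<^sub>R M"] show ?thesis by (simp add: matpowr_def)
qed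

lemma matpowr_add_mat:
  assumes "t > 0"
  shows "matpowr t (M + mat (of_nat k)) = t ^ k *\<^sub>R matpowr t M"
proof -
  have "exp (of_real (ln t) * of_nat k) = complex_of_real (t ^ k)"
    using assms by (simp add: exp_of_nat2_mult exp_of_real)
  then show ?thesis
    using matexp_add_mat[of "of_real (ln t)" M "of_nat k"]
    by (simp add: matpowr_def cscale_of_real del: of_real_power)
qed

definition beta_kernel ::
  "complex^'r^'r \<Rightarrow> complex^'r^'r \<Rightarrow> complex^'r^'r \<Rightarrow> real \<Rightarrow> complex^'r^'r" where
  "beta_kernel P Q X t = matpowr t (P - mat 1) ** matpowr (1 - t) (Q - mat 1) **
     matexp ((- 1 / (t * (1 - t))) *\<^sub>R X)"

lemma continuous_on_beta_kernel: "continuous_on {0<..<1} (beta_kernel P Q X)"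
  unfolding beta_kernel_def[abs_def] matpowr_def
  by (intro matmul.continuous_on continuous_on_matexp_scaleR continuous_intros) auto

text \<open>The exponential decay of \<open>exp (- s X)\<close> as \<open>s = 1 / (t (1 - t))\<close> tends to infinity
  beats the at most polynomial growth of the two power factors at the endpoints.\<close>

lemma beta_kernel_bounded:
  fixes P Q X :: "complex^'r^'r"
  assumes "positive_stable X"
  shows "\<exists>K\<ge>0. \<forall>t\<in>{0<..<1}. norm (beta_kernel P Q X t) \<le> K"
proof -
  define n where "n = nat \<lceil>max (CARD('r) * norm (P - mat 1)) (CARD('r) * norm (Q - mat 1))\<rceil>"
  have n: "CARD('r) * norm (P - mat 1) \<le> real n" "CARD('r) * norm (Q - mat 1) \<le> real n"
    unfolding n_def by linarith+
  define c where "c = real CARD('r) * real CARD('r)"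
  obtain K where K: "K > 0"
      "\<And>(M :: complex^'r^'r) (N :: complex^'r^'r). norm (M ** N) \<le> norm M * norm N * K"
    using matmul.pos_bounded by blast
  \<comment> \<open>The decay is taken with the same power \<open>n\<close>: for
    \<open>s = 1 / (t * (1 - t))\<close> the factor \<open>1 / s ^ n\<close> cancels both endpoint
    singularities exactly.\<close>
  obtain L where L: "L \<ge> 0" "\<And>s. s > 0 \<Longrightarrow> norm (matexp (- s *\<^sub>R X)) \<le> L / s ^ n"
    using norm_matexp_neg_le_power[OF assms] by blast
  have "norm (beta_kernel P Q X t) \<le> c * c * K * L * K" if t: "t \<in> {0<..<1}" for t
  proof -
    define s where "s = 1 / (t * (1 - t))"
    have s: "s > 0" using t by (simp add: s_def)
    have "norm (beta_kernel P Q X t) \<le>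
        norm (matpowr t (P - mat 1) ** matpowr (1 - t) (Q - mat 1)) * norm (matexp (- s *\<^sub>R X)) * K"
      unfolding beta_kernel_def using K(2) by (simp add: s_def)
    also have "\<dots> \<le> ((c / t ^ n) * (c / (1 - t) ^ n) * K) * (L / s ^ n) * K"
    proof (intro mult_right_mono mult_mono)
      have "norm (matpowr t (P - mat 1) ** matpowr (1 - t) (Q - mat 1))
          \<le> norm (matpowr t (P - mat 1)) * norm (matpowr (1 - t) (Q - mat 1)) * K"
        by (rule K(2))
      also have "\<dots> \<le> (c / t ^ n) * (c / (1 - t) ^ n) * K"
        using t K(1) n norm_matpowr_le[of t "P - mat 1" n] norm_matpowr_le[of "1 - t" "Q - mat 1" n]
        by (intro mult_right_mono mult_mono) (auto simp: c_def)
      finally show "norm (matpowr t (P - mat 1) ** matpowr (1 - t) (Q - mat 1))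
          \<le> (c / t ^ n) * (c / (1 - t) ^ n) * K" .
    qed (use L s K t in \<open>auto simp: c_def\<close>)
    also have "\<dots> = c * c * K * L * K"
      using t by (simp add: s_def power_mult_distrib power_divide)
    finally show ?thesis .
  qed
  moreover have "0 \<le> c * c * K * L * K" using K(1) L(1) by (simp add: c_def)
  ultimately show ?thesis by blast
qed

lemma set_integrable_beta_kernel:
  assumes "positive_stable X"
  shows "set_integrable lborel {0<..<1} (beta_kernel P Q X)"
  using beta_kernel_bounded[OF assms, of P Q] continuous_on_beta_kernel set_integrable_bounded_continuous
  by metis

lemma beta_kernel_add_mat:
  assumes "t > 0"
  shows "beta_kernel (P + mat (of_nat k)) Q X t = t ^ k *\<^sub>R beta_kernel P Q X t"
proof -
  have "P + mat (of_nat k) - mat 1 = (P - mat 1) + mat (of_nat k)" by simp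
  then show ?thesis
    by (simp only: beta_kernel_def matpowr_add_mat[OF assms] matmul.scaleR_left)
qed

section \<open>Unconditional summation of the double series and its integration\<close>

lemma has_sum_one_minus_powr_neg:
  fixes M :: "complex^'r^'r"
  assumes "norm s < 1"
  shows "((\<lambda>n. (s ^ n / fact n) *\<^sub>C matpochhammer M n) has_sum one_minus_powr_neg s M) UNIV"
proof (rule norm_summable_imp_has_sum)
  show "summable (\<lambda>n. norm ((s ^ n / fact n) *\<^sub>C matpochhammer M n))"
    using summable_matpochhammer[of "norm s" M] assms
    by (simp add: norm_cscale norm_divide norm_power mult.commute)
  show "(\<lambda>n. (s ^ n / fact n) *\<^sub>C matpochhammer M n) sums one_minus_powr_neg s M"
    unfolding sums_matrix_iff
    using summable_sums[OF summable_matpochhammer_entry[OF assms, of M]]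
    by (simp add: mult.commute one_minus_powr_neg_entry[OF assms])
qed

text \<open>For nonnegative terms iterated summability suffices, and row \<open>m\<close> has sum
  \<open>\<alpha> m * suminf \<beta>\<close>.\<close>

lemma summable_on_product_nonneg:
  fixes \<alpha> \<beta> :: "nat \<Rightarrow> real"
  assumes "summable \<alpha>" "summable \<beta>" "\<And>m. \<alpha> m \<ge> 0" "\<And>n. \<beta> n \<ge> 0"
  shows "(\<lambda>(m, n). \<alpha> m * \<beta> n) summable_on UNIV"
proof -
  have "(\<lambda>(m, n). \<alpha> m * \<beta> n) summable_on UNIV \<times> UNIV"
  proof (rule summable_on_SigmaI)
    have "(\<beta> has_sum suminf \<beta>) UNIV"
      using assms by (intro norm_summable_imp_has_sum) (auto intro: summable_sums)
    then show "((\<lambda>n. case (m, n) of (m, n) \<Rightarrow> \<alpha> m * \<beta> n) has_sum \<alpha> m * suminf \<beta>) UNIV" for m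
      by (simp add: has_sum_cmult_right)
    show "(\<lambda>m. \<alpha> m * suminf \<beta>) summable_on UNIV"
      using assms by (intro summable_on_cmult_left norm_summable_imp_summable_on) simp
  qed (use assms in auto)
  then show ?thesis by simp
qed

text \<open>\<open>infsum\<close> and the integral are 0 by default when they do not converge. The
  first two conjuncts exclude this, so the equation speaks of genuine values.\<close>

theorem theorem3p1:
  fixes A B B' C X :: "complex^'r^'r" and z w :: complex
  assumes "positive_stable A" and "positive_stable B" and "positive_stable B'"
    and "positive_stable C" and "positive_stable (C - A)" and "positive_stable X"
    and "A ** C = C ** A" and "A ** X = X ** A" and "C ** X = X ** C"
    and "C ** B = B ** C" and "C ** B' = B' ** C"
    and "norm z < 1" and "norm w < 1"
  shows "ext_appell_F1_term A B B' C z w X summable_on UNIV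
    \<and> set_integrable lborel {0<..<1} (\<lambda>u.
        matpowr u (A - mat 1) ** matpowr (1 - u) (C - A - mat 1) **
        matexp ((- 1 / (u * (1 - u))) *\<^sub>R X) **
        one_minus_powr_neg (z * of_real u) B ** one_minus_powr_neg (w * of_real u) B')
    \<and> ext_appell_F1 A B B' C z w X =
        matGamma C ** matrix_inv (matGamma A) ** matrix_inv (matGamma (C - A)) **
        (LINT u:{0<..<1}|lborel.
           matpowr u (A - mat 1) ** matpowr (1 - u) (C - A - mat 1) **
           matexp ((- 1 / (u * (1 - u))) *\<^sub>R X) **
           one_minus_powr_neg (z * of_real u) B ** one_minus_powr_neg (w * of_real u) B')"
proof -
  define G where "G = beta_kernel A (C - A) X"
  define a where "a m u = ((z * of_real u) ^ m / fact m) *\<^sub>C matpochhammer B m" for m and u :: real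
  define b where "b n u = ((w * of_real u) ^ n / fact n) *\<^sub>C matpochhammer B' n" for n and u :: real
  define h where "h = (\<lambda>(m, n) u. G u ** a m u ** b n u)"
  define f where "f u = G u ** one_minus_powr_neg (z * of_real u) B ** one_minus_powr_neg (w * of_real u) B'" for u
  \<comment> \<open>The pairs are enumerated by \<open>prod_decode\<close> because the interchange
    theorem concerns sequences; the indicator turns integrals over the interval into integrals over
    the line.\<close>
  define H where "H k u = indicator {0<..<1} u *\<^sub>R h (prod_decode k) u" for k and u :: real
  define tm where "tm = ext_appell_F1_term A B B' C z w X"
  define \<alpha> where "\<alpha> m = norm (matpochhammer B m) / fact m * norm z ^ m" for m
  define \<beta> where "\<beta> n = norm (matpochhammer B' n) / fact n * norm w ^ n" for n

  obtain K where K: "K > 0"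
      "\<And>(M :: complex^'r^'r) (N :: complex^'r^'r). norm (M ** N) \<le> norm M * norm N * K"
    using matmul.pos_bounded by blast
  obtain L where L: "L \<ge> 0" "\<And>u. u \<in> {0<..<1} \<Longrightarrow> norm (G u) \<le> L"
    using beta_kernel_bounded[OF assms(6)] unfolding G_def by blast
  \<comment> \<open>A majorant of \<open>h\<close> free of \<open>u\<close>; each of the two matrix
    products contributes one factor \<open>K\<close>.\<close>
  define bd where "bd = (\<lambda>(m, n). L * K * K * (\<alpha> m * \<beta> n))"

  have norm_a: "norm (a m u) \<le> \<alpha> m" and norm_b: "norm (b n u) \<le> \<beta> n" if "u \<in> {0<..<1}" for m n u
  proof -
    have "(norm z * u) ^ m \<le> norm z ^ m" "(norm w * u) ^ n \<le> norm w ^ n"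
      using that by (auto intro!: power_mono mult_left_le)
    moreover have "norm (a m u) = norm (matpochhammer B m) / fact m * (norm z * u) ^ m"
        "norm (b n u) = norm (matpochhammer B' n) / fact n * (norm w * u) ^ n"
      using that by (simp_all add: a_def b_def norm_cscale norm_divide norm_power norm_mult)
    ultimately show "norm (a m u) \<le> \<alpha> m" "norm (b n u) \<le> \<beta> n"
      by (simp_all only: \<alpha>_def \<beta>_def) (intro mult_left_mono; simp)+
  qed
  have norm_h: "norm (h p u) \<le> bd p" if u: "u \<in> {0<..<1}" for p u
  proof (cases p)
    case (Pair m n)
    have "norm (G u ** a m u ** b n u) \<le> norm (G u ** a m u) * norm (b n u) * K"
      by (rule K(2))
    also have "\<dots> \<le> (L * \<alpha> m * K) * \<beta> n * K"
    proof (intro mult_right_mono mult_mono)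
      have "norm (G u ** a m u) \<le> norm (G u) * norm (a m u) * K" by (rule K(2))
      also have "\<dots> \<le> L * \<alpha> m * K"
        using L K(1) u norm_a by (intro mult_right_mono mult_mono) auto
      finally show "norm (G u ** a m u) \<le> L * \<alpha> m * K" .
      show "0 \<le> L * \<alpha> m * K" using L(1) K(1) by (simp add: \<alpha>_def)
    qed (use u norm_b K(1) in auto)
    finally show ?thesis by (simp add: Pair h_def bd_def mult_ac)
  qed

  have "summable \<alpha>" "summable \<beta>"
    unfolding \<alpha>_def[abs_def] \<beta>_def[abs_def] using assms(12,13) by (simp_all only: summable_matpochhammer norm_ge_zero)
  then have "(\<lambda>(m, n). \<alpha> m * \<beta> n) summable_on UNIV"
    by (rule summable_on_product_nonneg) (simp_all add: \<alpha>_def \<beta>_def)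
  then have bd: "bd summable_on UNIV"
    unfolding bd_def by (auto dest: summable_on_cmult_right simp: case_prod_unfold)
  then have summable_bd: "summable (\<lambda>k. bd (prod_decode k))"
    by (intro summable_on_imp_summable) (simp add: summable_on_reindex_bij_betw[OF bij_prod_decode])
  have bd_nonneg: "bd p \<ge> 0" for p
    using L(1) K(1) by (auto simp: bd_def \<alpha>_def \<beta>_def split: prod.split)

  have h_has_sum: "((\<lambda>p. h p u) has_sum f u) UNIV" if u: "u \<in> {0<..<1}" for u
  proof -
    have "norm (z * of_real u) \<le> norm z" "norm (w * of_real u) \<le> norm w"
      using u by (auto simp: norm_mult intro: mult_left_le)
    with assms have zw: "norm (z * of_real u) < 1" "norm (w * of_real u) < 1" by linarith+
    \<comment> \<open>Summing over \<open>n\<close> first yields the factor with \<open>B'\<close>,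
      then summing over \<open>m\<close> the one with \<open>B\<close>; domination by
      \<open>bd\<close> makes the double sum equal to the iterated one.\<close>
    have "((\<lambda>p. h p u) has_sum f u) (UNIV \<times> UNIV)"
    proof (rule has_sum_SigmaI)
      show "((\<lambda>n. h (m, n) u) has_sum G u ** a m u ** one_minus_powr_neg (w * of_real u) B') UNIV" for m
        unfolding h_def b_def prod.case
        by (rule has_sum_bounded_linear[OF matmul.bounded_linear_right has_sum_one_minus_powr_neg[OF zw(2)]])
      show "((\<lambda>m. G u ** a m u ** one_minus_powr_neg (w * of_real u) B') has_sum f u) UNIV"
        unfolding f_def a_def
        by (rule has_sum_bounded_linear[OF matmul.bounded_linear_left
              has_sum_bounded_linear[OF matmul.bounded_linear_right has_sum_one_minus_powr_neg[OF zw(1)]]])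
      show "(\<lambda>p. h p u) summable_on UNIV \<times> UNIV"
        using Infinite_Sum.abs_summable_on_comparison_test'[OF bd, of "\<lambda>p. h p u"] norm_h[OF u]
        by (simp add: Infinite_Sum.abs_summable_summable)
    qed
    then show ?thesis by simp
  qed
  have sum_H: "(\<lambda>k. H k u) sums (indicator {0<..<1} u *\<^sub>R f u)" for u
  proof (cases "u \<in> {0<..<1}")
    case True
    have "((\<lambda>k. h (prod_decode k) u) has_sum f u) UNIV"
      using h_has_sum[OF True] has_sum_reindex_bij_betw[OF bij_prod_decode, of "\<lambda>p. h p u"] by simp
    then show ?thesis using True by (simp add: H_def has_sum_imp_sums)
  qed (simp add: H_def)

  have h_term: "h (m, n) u = (z ^ m * w ^ n / (fact m * fact n)) *\<^sub>C
      (beta_kernel (A + mat (of_nat (m + n))) (C - A) X u ** matpochhammer B m ** matpochhammer B' n)"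
    if "u \<in> {0<..<1}" for m n u
  proof -
    \<comment> \<open>The scalar \<open>u ^ (m + n)\<close> from the two binomial terms is exactly
      what raises the exponent \<open>A\<close> to \<open>A + (m + n) I\<close>.\<close>
    have "beta_kernel (A + mat (of_nat (m + n))) (C - A) X u = of_real (u ^ (m + n)) *\<^sub>C G u"
      using that by (simp only: cscale_of_real G_def beta_kernel_add_mat greaterThanLessThan_iff)
    then show ?thesis
      by (simp add: h_def a_def b_def cscale_matrix_mult matrix_mult_cscale cscale_cscale
          power_mult_distrib power_add mult_ac)
  qed
  have H_integral: "has_bochner_integral lborel (H k) (tm (prod_decode k))" for k
  proof -
    obtain m n where mn: "prod_decode k = (m, n)" by fastforce
    \<comment> \<open>Everything around the beta kernel is one bounded linear map, which commutes
      with the integral; the integral of the kernel is \<open>ext_beta\<close>.\<close>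
    define T where "T M = (z ^ m * w ^ n / (fact m * fact n)) *\<^sub>C
      (M ** matpochhammer B m ** matpochhammer B' n)" for M
    have T: "bounded_linear T"
      unfolding T_def
      by (intro bounded_linear_compose[OF bounded_linear_cscale] bounded_linear_compose[OF matmul.bounded_linear_left]
          matmul.bounded_linear_left)
    let ?G = "beta_kernel (A + mat (of_nat (m + n))) (C - A) X"
    have "H k = (\<lambda>u. T (indicator {0<..<1} u *\<^sub>R ?G u))"
      using T by (auto simp: H_def mn h_term T_def[symmetric] indicator_def linear_0 bounded_linear.linear)
    moreover have "integrable lborel (\<lambda>u. indicator {0<..<1} u *\<^sub>R ?G u)"
      using set_integrable_beta_kernel[OF assms(6)] by (simp add: set_integrable_def)
    then have "has_bochner_integral lborel (\<lambda>u. T (indicator {0<..<1} u *\<^sub>R ?G u))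
        (T (LINT u:{0<..<1}|lborel. ?G u))"
      unfolding set_lebesgue_integral_def
      by (intro has_bochner_integral_bounded_linear[OF T] has_bochner_integral_integrable)
    moreover have "tm (m, n) = T (LINT u:{0<..<1}|lborel. ?G u)"
      by (simp add: tm_def ext_appell_F1_term_def ext_beta_def T_def beta_kernel_def)
    ultimately show ?thesis by (simp only: mn)
  qed
  have integral_H: "integrable lborel (H k)" "integral\<^sup>L lborel (H k) = tm (prod_decode k)" for k
    using H_integral[of k] by (auto simp: has_bochner_integral_iff)

  have norm_H: "norm (H k u) \<le> bd (prod_decode k) * indicator {0<..<1} u" for k u
    using norm_h by (simp add: H_def indicator_def)
  have integral_norm_H: "(\<integral>u. norm (H k u) \<partial>lborel) \<le> bd (prod_decode k)" for k
  proof -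
    \<comment> \<open>The interval has length 1, so the integral of the majorant is
      \<open>bd\<close> itself.\<close>
    have "(\<integral>u. norm (H k u) \<partial>lborel) \<le> (\<integral>u. bd (prod_decode k) * indicator {0<..<1::real} u \<partial>lborel)"
      using integral_H norm_H by (intro integral_mono) auto
    then show ?thesis by simp
  qed
  have s1: "AE u in lborel. summable (\<lambda>k. norm (H k u))"
  proof (rule AE_I2)
    fix u
    have "norm (H k u) \<le> bd (prod_decode k)" for k
      using norm_H[of k u] bd_nonneg[of "prod_decode k"] by (cases "u \<in> {0<..<1}") (auto simp: indicator_def)
    then show "summable (\<lambda>k. norm (H k u))"
      by (intro summable_comparison_test'[OF summable_bd]) simp
  qed
  have s2: "summable (\<lambda>k. \<integral>u. norm (H k u) \<partial>lborel)"
    using integral_norm_H by (intro summable_comparison_test'[OF summable_bd]) simp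

  have suminf_H: "(\<Sum>k. H k u) = indicator {0<..<1} u *\<^sub>R f u" for u
    using sum_H sums_unique by metis
  have f_int: "set_integrable lborel {0<..<1} f"
    using integrable_suminf[OF integral_H(1) s1 s2] by (simp add: suminf_H set_integrable_def)
  have tm_sums: "(\<lambda>k. tm (prod_decode k)) sums (LINT u:{0<..<1}|lborel. f u)"
    using sums_integral[OF integral_H(1) s1 s2]
    by (simp add: suminf_H integral_H set_lebesgue_integral_def)
  \<comment> \<open>Absolute summability of the integrated terms makes the sum independent of the
    enumeration, so it can be carried back to pairs.\<close>
  have "norm (tm (prod_decode k)) \<le> bd (prod_decode k)" for k
    using integral_norm_bound[of lborel "H k"] integral_norm_H[of k] by (simp add: integral_H)
  then have "summable (\<lambda>k. norm (tm (prod_decode k)))"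
    by (intro summable_comparison_test'[OF summable_bd]) simp
  from norm_summable_imp_has_sum[OF this tm_sums]
  have tm_has_sum: "(tm has_sum (LINT u:{0<..<1}|lborel. f u)) UNIV"
    using has_sum_reindex_bij_betw[OF bij_prod_decode, of tm] by simp
  have f_eq: "f = (\<lambda>u. matpowr u (A - mat 1) ** matpowr (1 - u) (C - A - mat 1) **
        matexp ((- 1 / (u * (1 - u))) *\<^sub>R X) **
        one_minus_powr_neg (z * of_real u) B ** one_minus_powr_neg (w * of_real u) B')"
    by (simp add: f_def G_def beta_kernel_def fun_eq_iff)
  show ?thesis
    using tm_has_sum f_int
    unfolding f_eq ext_appell_F1_def tm_def by (auto dest: has_sum_imp_summable infsumI)
qed

end
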